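(* Let $n\ge1$, let $\mathbb{X}$ be an $n$-dimensional real Banach space and let $\mathcal{A}\subset\mathbb{X}\setminus\{0\}$ be a compact set. Suppose that there exist $f_1,f_2,\dots,f_n,f_{n+1}\in Exp(B_{\mathbb{X}^*})$ such that: (i) $\operatorname{span}\{f_1,f_2,\dots,f_n\}=\mathbb{X}^*$; (ii) $f_{n+1}\in cone(-f_1,-f_2,\dots,-f_n)$. Then $\mathcal{A}$ admits a ball covering consisting of $n+1$ balls.
   Context: For vectors $u_1,\dots,u_k$, $cone(u_1,\dots,u_k):=\{\sum_{i=1}^k\alpha_i u_i:\alpha_i>0,\ 1\le i\le k\}$. $Exp(B_{\mathbb{Z}})$ is the set of exposed points of the closed unit ball $B_{\mathbb{Z}}$: points $u\in S_{\mathbb{Z}}$ for which there is $u^*\in S_{\mathbb{Z}^*}$ with $u^*(u)=1$ and $u^*(v)<1$ for all $v\in S_{\mathbb{Z}}\setminus\{u\}$ ($S_{\mathbb{Z}}$ is the unit sphere of $\mathbb{Z}$). A set $\mathcal{A}\subset\mathbb{X}$ admits a ball covering consisting of $k$ balls if there are $x_1,\dots,x_k\in\mathbb{X}\setminus\{0\}$ and $0<r_i\le\|x_i\|$ with $\mathcal{A}\subseteq\bigcup_{i=1}^k B(x_i,r_i)$, where $B(x,r)$ is the open ball of center $x$ and radius $r$. *)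

theory Defs
  imports "HOL-Analysis.Analysis"
begin

text \<open>The dual space of a real normed space is rendered as the type of bounded linear
  functionals \<^typ>\<open>'a::real_normed_vector \<Rightarrow>\<^sub>L real\<close>, with the operator norm.\<close>

definition exposed_points_ball :: "'z::real_normed_vector set" where
  "exposed_points_ball =
     {u \<in> sphere 0 1. \<exists>u' :: 'z \<Rightarrow>\<^sub>L real. norm u' = 1 \<and> blinfun_apply u' u = 1 \<and>
        (\<forall>v \<in> sphere 0 1 - {u}. blinfun_apply u' v < 1)}"

text \<open>The coefficients are strictly positive, so this is not the closed conic hull; the library's
  \<^const>\<open>cone\<close> is a predicate on sets and unrelated to this operation.\<close>

definition pos_cone :: "nat \<Rightarrow> (nat \<Rightarrow> 'z::real_vector) \<Rightarrow> 'z set" where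
  "pos_cone k u = {(\<Sum>i=1..k. \<alpha> i *\<^sub>R u i) | \<alpha> :: nat \<Rightarrow> real. \<forall>i\<in>{1..k}. 0 < \<alpha> i}"

definition admits_ball_covering :: "'a::real_normed_vector set \<Rightarrow> nat \<Rightarrow> bool" where
  "admits_ball_covering A k \<longleftrightarrow>
     (\<exists>(x :: nat \<Rightarrow> 'a) (r :: nat \<Rightarrow> real).
        (\<forall>i\<in>{1..k}. x i \<noteq> 0 \<and> 0 < r i \<and> r i \<le> norm (x i)) \<and>
        A \<subseteq> (\<Union>i\<in>{1..k}. ball (x i) (r i)))"

end

theory Submission
  imports Defs
begin

text \<open>
  Let \<open>f\<close> be exposed in the dual ball. Since the dual is finite dimensional, the exposing functional
  is evaluation at a point \<open>x\<close> of the unit sphere (lemma \<open>exposing_vector\<close>), so \<open>f\<close> is the only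
  norm-one functional with value \<open>1\<close> at \<open>x\<close>. By the Hahn-Banach theorem this makes \<open>f\<close> the derivative
  of the norm at \<open>x\<close>, that is, \<open>\<parallel>t x - a\<parallel> - t\<close> tends to \<open>- f a\<close> as \<open>t\<close> grows. Hence, as soon as
  \<open>f a > 0\<close>, the point \<open>a\<close> lies in the ball of centre \<open>t x\<close> and radius \<open>t\<close> for some \<open>t\<close>
  (lemma \<open>exposed_halfspace_subset_balls\<close>), and therefore also for all larger \<open>t\<close>.

  The hypotheses on \<open>f\<^sub>1, \<dots>, f\<^sub>n\<^sub>+\<^sub>1\<close> say that the open half spaces \<open>f\<^sub>i > 0\<close> cover everything except
  the origin: if all \<open>f\<^sub>i a\<close> are nonpositive, then \<open>- f\<^sub>n\<^sub>+\<^sub>1 a\<close> is at the same time nonnegative and a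
  positive combination of the nonpositive numbers \<open>f\<^sub>1 a, \<dots>, f\<^sub>n a\<close>; so these all vanish, and
  \<open>a = 0\<close> because \<open>f\<^sub>1, \<dots>, f\<^sub>n\<close> span the dual (lemma \<open>positive_somewhere\<close>). So each point of \<open>A\<close> lies in one of the \<open>n + 1\<close> balls once \<open>t\<close> is large, and
  by compactness a single \<open>t\<close> serves all points of \<open>A\<close>.

  The form of the Hahn-Banach theorem used here is proved by repeatedly replacing a sublinear
  function by a smaller one, its one-sided derivative at a given vector, until it is linear. The
  same derivative, applied to the norm, gives the half space lemma.
\<close>

section \<open>Sublinear functions and their derivatives\<close>

definition sublinear :: "('a::real_vector \<Rightarrow> real) \<Rightarrow> bool" where
  "sublinear q \<longleftrightarrow>
     (\<forall>y z. q (y + z) \<le> q y + q z) \<and> (\<forall>c\<ge>0. \<forall>y. q (c *\<^sub>R y) = c * q y)"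

lemma sublinear_add: "sublinear q \<Longrightarrow> q (y + z) \<le> q y + q z"
  by (simp add: sublinear_def)

lemma sublinear_scale: "sublinear q \<Longrightarrow> c \<ge> 0 \<Longrightarrow> q (c *\<^sub>R y) = c * q y"
  by (simp add: sublinear_def)

lemma sublinear_zero: "sublinear q \<Longrightarrow> q 0 = 0"
  using sublinear_scale[of q 0 0] by simp

lemma sublinear_minus: "sublinear q \<Longrightarrow> - q (- y) \<le> q y"
  using sublinear_add[of q y "- y"] sublinear_zero[of q] by simp

lemma sublinearI:
  assumes add: "\<And>y z. q (y + z) \<le> q y + q z" and zero: "q 0 = 0"
    and scale: "\<And>c y. c > 0 \<Longrightarrow> q (c *\<^sub>R y) \<le> c * q y"
  shows "sublinear q"
proof -
  have "q (c *\<^sub>R y) = c * q y" if "c \<ge> 0" for c y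
  proof (cases "c = 0")
    case False
    with that have c: "c > 0" by simp
    have "q ((1 / c) *\<^sub>R (c *\<^sub>R y)) \<le> (1 / c) * q (c *\<^sub>R y)"
      using c by (intro scale) simp
    then have "c * q y \<le> q (c *\<^sub>R y)"
      using c by (simp add: field_simps)
    with scale[OF c, of y] show ?thesis by simp
  qed (simp add: zero)
  with add show ?thesis by (simp add: sublinear_def)
qed

lemma sublinear_norm: "sublinear (norm :: 'a::real_normed_vector \<Rightarrow> real)"
  by (simp add: sublinear_def norm_triangle_ineq)

text \<open>The quantity below is the one-sided derivative of \<open>q\<close> at \<open>b\<close> in the direction \<open>y\<close>: for \<open>s > 0\<close> the
  term equals the difference quotient of \<open>q\<close> with step \<open>1 / s\<close>, which by convexity does not increase
  as \<open>s\<close> grows. Writing the limit as an infimum avoids any discussion of convergence.\<close>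

definition sublinear_deriv :: "('a::real_vector \<Rightarrow> real) \<Rightarrow> 'a \<Rightarrow> 'a \<Rightarrow> real" where
  "sublinear_deriv q b y = (INF s\<in>{0..}. q (y + s *\<^sub>R b) - s * q b)"

lemma sublinear_deriv_bound:
  assumes "sublinear q" "s \<ge> 0"
  shows "- q (- y) \<le> q (y + s *\<^sub>R b) - s * q b"
  using sublinear_add[OF assms(1), of "y + s *\<^sub>R b" "- y"] sublinear_scale[OF assms, of b] by simp

lemma sublinear_deriv_bdd_below:
  "sublinear q \<Longrightarrow> bdd_below ((\<lambda>s. q (y + s *\<^sub>R b) - s * q b) ` {0..})"
  using sublinear_deriv_bound by (intro bdd_belowI[where m = "- q (- y)"]) auto

lemma sublinear_deriv_le_quotient:
  "sublinear q \<Longrightarrow> s \<ge> 0 \<Longrightarrow> sublinear_deriv q b y \<le> q (y + s *\<^sub>R b) - s * q b"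
  unfolding sublinear_deriv_def by (intro cINF_lower sublinear_deriv_bdd_below) auto

lemma sublinear_deriv_geI:
  "(\<And>s. s \<ge> 0 \<Longrightarrow> m \<le> q (y + s *\<^sub>R b) - s * q b) \<Longrightarrow> m \<le> sublinear_deriv q b y"
  unfolding sublinear_deriv_def by (intro cINF_greatest) auto

lemma sublinear_deriv_le: "sublinear q \<Longrightarrow> sublinear_deriv q b y \<le> q y"
  using sublinear_deriv_le_quotient[of q 0 b y] by simp

lemma sublinear_deriv_minus: "sublinear q \<Longrightarrow> sublinear_deriv q b (- b) \<le> - q b"
  using sublinear_deriv_le_quotient[of q 1 b "- b"] sublinear_zero[of q] by simp

lemma sublinear_deriv_sublinear:
  assumes q: "sublinear q"
  shows "sublinear (sublinear_deriv q b)"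
proof (rule sublinearI)
  fix y z
  have "sublinear_deriv q b (y + z) - (q (z + t *\<^sub>R b) - t * q b) \<le> q (y + s *\<^sub>R b) - s * q b"
    if "s \<ge> 0" "t \<ge> 0" for s t
  proof -
    have "sublinear_deriv q b (y + z) \<le> q ((y + z) + (s + t) *\<^sub>R b) - (s + t) * q b"
      using that by (intro sublinear_deriv_le_quotient q) simp
    moreover have "q ((y + z) + (s + t) *\<^sub>R b) \<le> q (y + s *\<^sub>R b) + q (z + t *\<^sub>R b)"
      using sublinear_add[OF q, of "y + s *\<^sub>R b" "z + t *\<^sub>R b"] by (simp add: algebra_simps)
    ultimately show ?thesis by (simp add: algebra_simps)
  qed
  then have "sublinear_deriv q b (y + z) - (q (z + t *\<^sub>R b) - t * q b) \<le> sublinear_deriv q b y"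
    if "t \<ge> 0" for t
    using that by (intro sublinear_deriv_geI) auto
  then have "sublinear_deriv q b (y + z) - sublinear_deriv q b y \<le> sublinear_deriv q b z"
    by (intro sublinear_deriv_geI) (auto simp: algebra_simps)
  then show "sublinear_deriv q b (y + z) \<le> sublinear_deriv q b y + sublinear_deriv q b z"
    by simp
next
  have "0 \<le> sublinear_deriv q b 0"
    using sublinear_deriv_bound[OF q, of _ 0 b] sublinear_zero[OF q]
    by (intro sublinear_deriv_geI) auto
  then show "sublinear_deriv q b 0 = 0"
    using sublinear_deriv_le[OF q, of b 0] sublinear_zero[OF q] by simp
next
  fix c :: real and y
  assume c: "c > 0"
  have "(1 / c) * sublinear_deriv q b (c *\<^sub>R y) \<le> q (y + s *\<^sub>R b) - s * q b" if "s \<ge> 0" for s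
  proof -
    have "sublinear_deriv q b (c *\<^sub>R y) \<le> q (c *\<^sub>R y + (c * s) *\<^sub>R b) - (c * s) * q b"
      using c that by (intro sublinear_deriv_le_quotient q) simp
    also have "c *\<^sub>R y + (c * s) *\<^sub>R b = c *\<^sub>R (y + s *\<^sub>R b)"
      by (simp add: scaleR_add_right)
    also have "q \<dots> = c * q (y + s *\<^sub>R b)"
      using c by (intro sublinear_scale q) simp
    finally show ?thesis
      using c by (simp add: field_simps)
  qed
  then have "(1 / c) * sublinear_deriv q b (c *\<^sub>R y) \<le> sublinear_deriv q b y"
    by (intro sublinear_deriv_geI)
  then show "sublinear_deriv q b (c *\<^sub>R y) \<le> c * sublinear_deriv q b y"
    using c by (simp add: field_simps)
qed

section \<open>The Hahn-Banach theorem in finite dimension\<close>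

text \<open>Passing to the derivative at \<open>b\<close> makes a sublinear function odd at \<open>b\<close>, and oddness at a vector
  survives every later passage to a smaller sublinear function. So finitely many vectors can be
  treated one after the other.\<close>

lemma sublinear_minorant_odd_on_finite:
  fixes q :: "'a::real_vector \<Rightarrow> real"
  assumes "finite S" "sublinear q"
  shows "\<exists>p. sublinear p \<and> (\<forall>y. p y \<le> q y) \<and> (\<forall>b\<in>S. p (- b) = - p b)"
  using assms
proof (induction S)
  case empty
  then show ?case by auto
next
  case (insert b S)
  then obtain p where p: "sublinear p" "\<And>y. p y \<le> q y" "\<And>c. c \<in> S \<Longrightarrow> p (- c) = - p c"
    by blast
  let ?d = "sublinear_deriv p b"
  have d: "sublinear ?d" and le: "\<And>y. ?d y \<le> p y"
    using p(1) by (auto intro: sublinear_deriv_sublinear sublinear_deriv_le)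
  \<comment> \<open>Sublinearity already gives one of the two inequalities in oddness.\<close>
  have odd: "?d (- c) = - ?d c" if "?d (- c) \<le> - p c" for c
    using sublinear_minus[OF d, of c] le[of c] that by linarith
  have "?d (- c) = - ?d c" if "c \<in> insert b S" for c
  proof (cases "c = b")
    case True
    then show ?thesis by (auto intro: odd sublinear_deriv_minus p(1))
  next
    case False
    with that p(3) le[of "- c"] show ?thesis by (auto intro: odd)
  qed
  moreover have "?d y \<le> q y" for y
    using le[of y] p(2)[of y] by linarith
  ultimately show ?case using d by blast
qed

lemma sublinear_linear_if_odd:
  assumes p: "sublinear p" and odd: "\<And>b. b \<in> S \<Longrightarrow> p (- b) = - p b" and S: "span S = UNIV"
  shows "linear p"
proof -
  have scale: "p (c *\<^sub>R y) = c * p y" if "p (- y) = - p y" for c y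
  proof (cases "c \<ge> 0")
    case False
    then have "p ((- c) *\<^sub>R (- y)) = (- c) * p (- y)"
      by (intro sublinear_scale p) simp
    with that show ?thesis by simp
  qed (simp add: sublinear_scale p)
  have "subspace {y. p (- y) = - p y}"
  proof (rule subspaceI, safe)
    show "p (- 0) = - p 0" by (simp add: sublinear_zero p)
  next
    fix y z assume "p (- y) = - p y" "p (- z) = - p z"
    then show "p (- (y + z)) = - p (y + z)"
      using sublinear_add[OF p, of y z] sublinear_add[OF p, of "- y" "- z"]
        sublinear_minus[OF p, of "y + z"] by simp
  next
    fix c y assume "p (- y) = - p y"
    then show "p (- (c *\<^sub>R y)) = - p (c *\<^sub>R y)"
      using scale[of y c] scale[of y "- c"] by simp
  qed
  moreover have "S \<subseteq> {y. p (- y) = - p y}" using odd by auto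
  ultimately have "span S \<subseteq> {y. p (- y) = - p y}" by (intro span_minimal)
  with S have all: "p (- y) = - p y" for y by auto
  show ?thesis
  proof (rule linearI)
    fix y z
    show "p (y + z) = p y + p z"
      using sublinear_add[OF p, of y z] sublinear_add[OF p, of "- y" "- z"] all[of "y + z"]
      by (simp add: all)
  qed (simp add: scale all)
qed

text \<open>Starting from the derivative of \<open>q\<close> at \<open>x\<close> rather than from \<open>q\<close> itself forces the value at \<open>x\<close>.\<close>

lemma hahn_banach_finite_dim:
  fixes q :: "'a::real_vector \<Rightarrow> real"
  assumes "finite S" "span S = (UNIV :: 'a set)" and q: "sublinear q"
  obtains g where "linear g" "\<And>y. g y \<le> q y" "g x = q x"
proof -
  obtain g where g: "sublinear g" "\<And>y. g y \<le> sublinear_deriv q x y" "\<And>b. b \<in> S \<Longrightarrow> g (- b) = - g b"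
    using sublinear_minorant_odd_on_finite[OF assms(1) sublinear_deriv_sublinear[OF q, of x]] by blast
  have lin: "linear g"
    using sublinear_linear_if_odd g assms(2) by blast
  have le: "g y \<le> q y" for y
    using g(2)[of y] sublinear_deriv_le[OF q, of x y] by linarith
  have "- g x \<le> - q x"
    using g(2)[of "- x"] sublinear_deriv_minus[OF q, of x] linear_neg[OF lin, of x] by simp
  with le[of x] have "g x = q x" by simp
  with lin le that show thesis by blast
qed

lemma linear_le_norm_blinfun:
  fixes g :: "'a::real_normed_vector \<Rightarrow> real"
  assumes "linear g" "\<And>y. g y \<le> norm y"
  obtains h :: "'a \<Rightarrow>\<^sub>L real" where "blinfun_apply h = g" "norm h \<le> 1"
proof -
  have abs: "\<bar>g y\<bar> \<le> norm y" for y
    using assms(2)[of y] assms(2)[of "- y"] linear_neg[OF assms(1), of y] by simp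
  then have bl: "bounded_linear g"
    by (intro bounded_linear_intro[where K = 1])
      (auto simp: linear_add[OF assms(1)] linear_scale[OF assms(1)])
  have "norm (Blinfun g) \<le> 1"
    using abs by (intro norm_blinfun_bound) (auto simp: bounded_linear_Blinfun_apply[OF bl])
  with that bounded_linear_Blinfun_apply[OF bl] show thesis by blast
qed

lemma norming_functional:
  fixes x :: "'a::real_normed_vector"
  assumes "finite S" "span S = (UNIV :: 'a set)"
  obtains h :: "'a \<Rightarrow>\<^sub>L real" where "norm h \<le> 1" "blinfun_apply h x = norm x"
proof -
  obtain g :: "'a \<Rightarrow> real" where g: "linear g" "\<And>y. g y \<le> norm y" "g x = norm x"
    using hahn_banach_finite_dim[OF assms sublinear_norm, of x] by metis
  with linear_le_norm_blinfun[OF g(1,2)] that show thesis by metis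
qed

section \<open>The bidual of a space with finite-dimensional dual\<close>

text \<open>Functionals are separated from a finite-dimensional space of functionals by vectors. The
  induction is Gaussian elimination: a vector dual to the new functional \<open>d\<close> is used to
  eliminate \<open>d\<close> from both \<open>c\<close> and the vector found for the smaller set.\<close>

lemma separating_vector:
  fixes F :: "('a::real_normed_vector \<Rightarrow>\<^sub>L real) set"
  assumes "finite F" "c \<notin> span F"
  shows "\<exists>h. (\<forall>g\<in>F. blinfun_apply g h = 0) \<and> blinfun_apply c h \<noteq> 0"
  using assms
proof (induction F arbitrary: c)
  case empty
  then have "c \<noteq> 0" by simp
  then show ?case by (auto intro: blinfun_eqI)
next
  case (insert d F)
  show ?case
  proof (cases "d \<in> span F")
    case True
    then have "c \<notin> span F"
      using insert.prems span_mono[of F "insert d F"] by blast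
    then obtain h where h: "\<forall>g\<in>F. blinfun_apply g h = 0" "blinfun_apply c h \<noteq> 0"
      using insert.IH by blast
    have "linear (\<lambda>g. blinfun_apply g h)"
      by (rule linearI) (simp_all add: blinfun.bilinear_simps)
    then have "blinfun_apply d h = 0"
      using linear_eq_0_on_span[of "\<lambda>g. blinfun_apply g h" F d] True h(1) by blast
    with h show ?thesis by auto
  next
    case False
    then obtain h where h: "\<forall>g\<in>F. blinfun_apply g h = 0" "blinfun_apply d h \<noteq> 0"
      using insert.IH by blast
    \<comment> \<open>\<open>c - r d\<close> agrees with \<open>c\<close> modulo \<open>d\<close> and vanishes at \<open>h\<close>.\<close>
    define r where "r = blinfun_apply c h / blinfun_apply d h"
    have "c - r *\<^sub>R d \<notin> span F"
      using insert.prems by (auto simp: span_insert)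
    then obtain k where k: "\<forall>g\<in>F. blinfun_apply g k = 0" "blinfun_apply (c - r *\<^sub>R d) k \<noteq> 0"
      using insert.IH by blast
    define w where "w = k - (blinfun_apply d k / blinfun_apply d h) *\<^sub>R h"
    have "\<forall>g\<in>insert d F. blinfun_apply g w = 0"
      using h k(1) by (auto simp: w_def blinfun.bilinear_simps)
    moreover have "blinfun_apply c w \<noteq> 0"
      using k(2) h(2) by (simp add: w_def r_def blinfun.bilinear_simps field_simps)
    ultimately show ?thesis by blast
  qed
qed

lemma interpolating_vector:
  fixes F :: "('a::real_normed_vector \<Rightarrow>\<^sub>L real) set" and u :: "('a \<Rightarrow>\<^sub>L real) \<Rightarrow> real"
  assumes "finite F" "linear u"
  shows "\<exists>x. \<forall>g\<in>span F. blinfun_apply g x = u g"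
  using assms(1)
proof (induction F)
  case empty
  then show ?case by (simp add: linear_0[OF assms(2)])
next
  case (insert d F)
  then obtain x where x: "\<And>g. g \<in> span F \<Longrightarrow> blinfun_apply g x = u g" by blast
  show ?case
  proof (cases "d \<in> span F")
    case True
    then have "span (insert d F) = span F" by (rule span_redundant)
    with x show ?thesis by auto
  next
    case False
    then obtain h where h: "\<forall>g\<in>F. blinfun_apply g h = 0" "blinfun_apply d h \<noteq> 0"
      using separating_vector insert.hyps(1) by blast
    define w where "w = x + ((u d - blinfun_apply d x) / blinfun_apply d h) *\<^sub>R h"
    have "linear (\<lambda>g. blinfun_apply g w)"
      by (rule linearI) (simp_all add: blinfun.bilinear_simps)
    moreover have "blinfun_apply g w = u g" if "g \<in> insert d F" for g
      using that h x[OF span_base] by (auto simp: w_def blinfun.bilinear_simps)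
    ultimately have "\<forall>g\<in>span (insert d F). blinfun_apply g w = u g"
      using linear_eq_on_span[of "\<lambda>g. blinfun_apply g w" u "insert d F"] assms(2) by blast
    then show ?thesis by blast
  qed
qed

text \<open>The exposing functional \<open>u\<close> is evaluation at some \<open>x\<close>. The bound
  \<open>\<parallel>x\<parallel> \<le> 1\<close> is where the Hahn-Banach
  theorem enters: a functional norming \<open>x\<close>
  bounds \<open>\<parallel>x\<parallel>\<close> by \<open>\<parallel>u\<parallel>\<close>.\<close>

lemma exposing_vector:
  fixes f :: "'a::real_normed_vector \<Rightarrow>\<^sub>L real"
  assumes S: "finite S" "span S = (UNIV :: 'a set)"
    and F: "finite F" "span F = (UNIV :: ('a \<Rightarrow>\<^sub>L real) set)"
    and f: "f \<in> exposed_points_ball"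
  obtains x where "norm x = 1"
    "\<And>g. norm g = 1 \<Longrightarrow> blinfun_apply g x = 1 \<Longrightarrow> g = f"
proof -
  obtain u :: "('a \<Rightarrow>\<^sub>L real) \<Rightarrow>\<^sub>L real" where nf: "norm f = 1"
    and u: "norm u = 1" "blinfun_apply u f = 1" "\<And>g. norm g = 1 \<Longrightarrow> g \<noteq> f \<Longrightarrow> blinfun_apply u g < 1"
    using f by (auto simp: exposed_points_ball_def)
  have "linear (blinfun_apply u)"
    by (rule linearI) (simp_all add: blinfun.bilinear_simps)
  then obtain x where x: "\<And>g. blinfun_apply g x = blinfun_apply u g"
    using interpolating_vector[OF F(1)] F(2) by fastforce
  obtain h :: "'a \<Rightarrow>\<^sub>L real" where h: "norm h \<le> 1" "blinfun_apply h x = norm x"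
    using norming_functional[OF S] by metis
  have "norm x \<le> 1"
    using norm_blinfun[of u h] h u(1) x[of h] by simp
  moreover have "1 \<le> norm x"
    using norm_blinfun[of f x] nf u(2) x[of f] by simp
  ultimately have "norm x = 1" by simp
  moreover have "g = f" if "norm g = 1" "blinfun_apply g x = 1" for g
    using u(3)[of g] that x[of g] by force
  ultimately show thesis using that by blast
qed

section \<open>Half spaces as increasing unions of balls\<close>

text \<open>Every linear functional below the derivative of the norm at \<open>x\<close> has norm one and value one
  at \<open>x\<close>, hence equals \<open>f\<close>. By the Hahn-Banach theorem that derivative is then \<open>f\<close> itself, and so
  it is negative in the direction \<open>- a\<close>.\<close>

lemma exposed_halfspace_subset_balls:
  fixes f :: "'a::real_normed_vector \<Rightarrow>\<^sub>L real"
  assumes S: "finite S" "span S = (UNIV :: 'a set)"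
    and x: "norm x = 1" "\<And>g. norm g = 1 \<Longrightarrow> blinfun_apply g x = 1 \<Longrightarrow> g = f"
    and a: "blinfun_apply f a > 0"
  shows "\<exists>t>0. a \<in> ball (t *\<^sub>R x) t"
proof -
  let ?p = "sublinear_deriv norm x"
  obtain g where g: "linear g" "\<And>y. g y \<le> ?p y" "g (- a) = ?p (- a)"
    using hahn_banach_finite_dim[OF S sublinear_deriv_sublinear[OF sublinear_norm]] by metis
  have "g y \<le> norm y" for y
    using g(2)[of y] sublinear_deriv_le[OF sublinear_norm, of x y] by linarith
  then obtain h :: "'a \<Rightarrow>\<^sub>L real" where h: "blinfun_apply h = g" "norm h \<le> 1"
    using linear_le_norm_blinfun[OF g(1)] by metis
  have "g x \<ge> 1"
    using g(2)[of "- x"] sublinear_deriv_minus[OF sublinear_norm, of x] linear_neg[OF g(1), of x] x(1)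
    by simp
  moreover have "g x \<le> norm h"
    using norm_blinfun[of h x] h(1) x(1) by simp
  ultimately have "norm h = 1" "blinfun_apply h x = 1"
    using h by auto
  then have "h = f" by (rule x(2))
  with h(1) g(1,3) a have neg: "?p (- a) < 0"
    by (auto simp: linear_neg)
  obtain s where s: "s \<ge> 0" "norm (- a + s *\<^sub>R x) - s * norm x < 0"
  proof (rule ccontr)
    assume "\<not> thesis"
    then have "0 \<le> ?p (- a)"
      using that by (intro sublinear_deriv_geI) force
    with neg show False by simp
  qed
  have "norm (s *\<^sub>R x - a) < s"
    using s(2) x(1) by simp
  moreover from this have "s > 0"
    using norm_ge_zero[of "s *\<^sub>R x - a"] by linarith
  ultimately show ?thesis
    by (auto simp: dist_norm)
qed

text \<open>The distance of the two centres is exactly the difference of the radii.\<close>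

lemma balls_through_origin_mono:
  fixes x :: "'a::real_normed_vector"
  assumes "norm x = 1" "s \<le> t"
  shows "ball (s *\<^sub>R x) s \<subseteq> ball (t *\<^sub>R x) t"
proof
  fix a assume a: "a \<in> ball (s *\<^sub>R x) s"
  have "dist (t *\<^sub>R x) (s *\<^sub>R x) = t - s"
    using assms by (simp add: dist_norm flip: scaleR_left_diff_distrib)
  with a dist_triangle[of "t *\<^sub>R x" a "s *\<^sub>R x"] show "a \<in> ball (t *\<^sub>R x) t"
    by simp
qed

lemma positive_somewhere:
  fixes f :: "nat \<Rightarrow> 'a::real_normed_vector \<Rightarrow>\<^sub>L real"
  assumes S: "finite S" "span S = (UNIV :: 'a set)"
    and F: "span (f ` {1..n}) = UNIV"
    and cone: "f (n+1) \<in> pos_cone n (\<lambda>i. - f i)"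
    and a: "a \<noteq> 0"
  shows "\<exists>i\<in>{1..n+1}. blinfun_apply (f i) a > 0"
proof (rule ccontr)
  assume "\<not> ?thesis"
  then have nonpos: "blinfun_apply (f i) a \<le> 0" if "i \<in> {1..n+1}" for i
    using that by force
  obtain \<alpha> where \<alpha>: "\<And>i. i \<in> {1..n} \<Longrightarrow> 0 < \<alpha> i" "f (n+1) = (\<Sum>i=1..n. \<alpha> i *\<^sub>R (- f i))"
    using cone unfolding pos_cone_def by blast
  have "blinfun_apply (f (n+1)) a = (\<Sum>i=1..n. \<alpha> i * (- blinfun_apply (f i) a))"
    unfolding \<alpha>(2) by (simp add: blinfun.bilinear_simps blinfun.sum_left)
  moreover have terms: "\<alpha> i * (- blinfun_apply (f i) a) \<ge> 0" if "i \<in> {1..n}" for i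
    using \<alpha>(1)[OF that] nonpos[of i] that by (intro mult_nonneg_nonneg) auto
  ultimately have "(\<Sum>i=1..n. \<alpha> i * (- blinfun_apply (f i) a)) = 0"
    using nonpos[of "n+1"] sum_nonneg[of "{1..n}" "\<lambda>i. \<alpha> i * (- blinfun_apply (f i) a)"] by force
  then have "\<alpha> i * (- blinfun_apply (f i) a) = 0" if "i \<in> {1..n}" for i
    using that terms sum_nonneg_eq_0_iff[of "{1..n}" "\<lambda>i. \<alpha> i * (- blinfun_apply (f i) a)"] by blast
  then have zero: "blinfun_apply g a = 0" if "g \<in> f ` {1..n}" for g
    using \<alpha>(1) that by fastforce
  obtain h :: "'a \<Rightarrow>\<^sub>L real" where h: "blinfun_apply h a = norm a"
    using norming_functional[OF S] by metis
  have "linear (\<lambda>g. blinfun_apply g a)"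
    by (rule linearI) (simp_all add: blinfun.bilinear_simps)
  then have "blinfun_apply h a = 0"
    using linear_eq_0_on_span[of "\<lambda>g. blinfun_apply g a" "f ` {1..n}" h] zero F by blast
  with h a show False by simp
qed

theorem theorem3p25:
  fixes n :: nat
    and A :: "'a::banach set"
    and f :: "nat \<Rightarrow> 'a \<Rightarrow>\<^sub>L real"
  assumes "n \<ge> 1"
    and "dim (UNIV :: 'a set) = n"
    and "compact A"
    and "A \<subseteq> UNIV - {0}"
    and "\<forall>i\<in>{1..n+1}. f i \<in> exposed_points_ball"
    and "span (f ` {1..n}) = UNIV"
    and "f (n+1) \<in> pos_cone n (\<lambda>i. - f i)"
  shows "admits_ball_covering A (n+1)"
proof -
  obtain S :: "'a set" where S: "UNIV \<subseteq> span S" "card S = n"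
    using basis_exists[of "UNIV :: 'a set"] assms(2) by metis
  \<comment> \<open>An infinite basis would give the default cardinality, and hence the default dimension, zero.\<close>
  have fin: "finite S" and span: "span S = UNIV"
    using S assms(1) by (auto intro: card_ge_0_finite)
  have "\<forall>i\<in>{1..n+1}. \<exists>x. norm x = 1 \<and> (\<forall>g. norm g = 1 \<longrightarrow> blinfun_apply g x = 1 \<longrightarrow> g = f i)"
  proof
    fix i assume "i \<in> {1..n+1}"
    with assms(5) have "f i \<in> exposed_points_ball" by blast
    from exposing_vector[OF fin span _ assms(6) this]
    show "\<exists>x. norm x = 1 \<and> (\<forall>g. norm g = 1 \<longrightarrow> blinfun_apply g x = 1 \<longrightarrow> g = f i)"
      by (metis finite_atLeastAtMost finite_imageI)
  qed
  then obtain x where x: "\<And>i. i \<in> {1..n+1} \<Longrightarrow> norm (x i) = 1"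
    "\<And>i g. i \<in> {1..n+1} \<Longrightarrow> norm g = 1 \<Longrightarrow> blinfun_apply g (x i) = 1 \<Longrightarrow> g = f i"
    by metis
  define U where "U t = (\<Union>i\<in>{1..n+1}. ball (t *\<^sub>R x i) t)" for t :: real
  have mono: "U s \<subseteq> U t" if "s \<le> t" for s t
    using balls_through_origin_mono[OF x(1) that] unfolding U_def by blast
  have "A \<subseteq> (\<Union>t\<in>{0<..}. U t)"
  proof
    fix a assume "a \<in> A"
    then obtain i where i: "i \<in> {1..n+1}" "blinfun_apply (f i) a > 0"
      using positive_somewhere[OF fin span assms(6,7), of a] assms(4) by blast
    from exposed_halfspace_subset_balls[OF fin span x(1)[OF i(1)] x(2)[OF i(1)] i(2)] i(1)
    show "a \<in> (\<Union>t\<in>{0<..}. U t)" unfolding U_def by blast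
  qed
  moreover have "open (U t)" for t
    by (auto simp: U_def)
  ultimately obtain T where T: "T \<subseteq> {0<..}" "finite T" "A \<subseteq> (\<Union>t\<in>T. U t)"
    using compactE_image[OF assms(3), of "{0<..}" U] by metis
  \<comment> \<open>If \<open>A\<close> is empty, \<open>T\<close> may be empty too; the element \<open>1\<close> then supplies a positive radius.\<close>
  define r where "r = Max (insert 1 T)"
  have r: "t \<le> r" if "t \<in> insert 1 T" for t
    using that T(2) by (simp add: r_def)
  have "r > 0"
    using r[of 1] by simp
  have "A \<subseteq> U r"
    using T(3) mono r by blast
  then show ?thesis
    unfolding admits_ball_covering_def U_def
    using \<open>r > 0\<close> x(1) by (intro exI[of _ "\<lambda>i. r *\<^sub>R x i"] exI[of _ "\<lambda>_. r"]) force
qed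

end
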